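(* Let $e$ be an expression of the (reactive) article template program calculus with $\cdot\vdash e:\mathsf{ReactNode}$, and suppose $e$ evaluates to the value $v_0$. Let $i\in\mathbb{N}$ and let $v_i=\mathsf{doc\text{-}step}^i(v_0)$ be the result of $i$ steps of the reactive runtime (each step with an arbitrary map of signals). Let $a_i=\mathsf{doc\text{-}view}(v_i)$. Then $\mathsf{simple}(a_i)=\mathsf{incr}(a_i)$.
   Context: **Language.** The language is System F with strings ($\mathsf{Str}$), labelled products and sums, iso-recursive types, existential types and fixpoints, under standard call-by-value semantics, extended with templates (sugar for core terms constructing lists of nodes, including $\mathbf{reacttpl}\ t$ producing a list of reactive nodes, in which a template part $\mathbf{component}\ e_1\ e_2$ stands for $\mathsf{inst}(\mathsf{instantiate}\ e_1\ e_2)$). For the claim only the closed values of the following types matter. **Plain document trees.** $\mathsf{NodeTy}$ is the type of finite trees that are either $\mathsf{text}(s)$ with $s$ a string or $\mathsf{node}(s,at,ns)$ with tag $s$, attribute list $at$ of pairs of strings, and child list $ns$ of trees. **Reactive documents.** $\mathsf{ReactNode}$ is the type of finite trees that are $\mathsf{text}(s)$, or $\mathsf{node}(s,at,ns)$ with $ns$ a list of $\mathsf{ReactNode}$s, or $\mathsf{inst}(I)$ with $I$ an instance. A component with property type $P$ and state type $S$ is a record with $\mathsf{init}:P\to S$, $\mathsf{update}:\mathsf{Signal}\times S\to S$, $\mathsf{view}:S\to\mathsf{ReactNode}$, where $\mathsf{Signal}=\mathsf{Str}$. An instance is (an existential package over $P,S$ of) a record with fields $\mathsf{id}$ (an identifier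 in a set $\mathsf{InstId}$), $\mathsf{com}$ (a component for $P,S$), $\mathsf{props}:P$, $\mathsf{state}:S$, $\mathsf{node}:\mathsf{ReactNode}$. $\mathsf{instantiate}\ com\ props$ builds an instance with a fresh identifier, state $com.\mathsf{init}(props)$ and node $com.\mathsf{view}$ of that state. **Runtime.** Given a finite partial map $sig$ from $\mathsf{InstId}$ to $\mathsf{Signal}$, $\mathsf{doc\text{-}step}\ sig$ maps $\mathsf{text}(s)$ to itself, $\mathsf{node}(s,at,ns)$ to $\mathsf{node}(s,at,ns')$ with $ns'$ obtained by stepping each child, and $\mathsf{inst}(I)$ as follows. If $I.\mathsf{id}\notin\mathrm{dom}(sig)$, the result is $\mathsf{inst}(I')$ where $I'$ is $I$ with $\mathsf{node}$ replaced by $\mathsf{doc\text{-}step}\ sig\ I.\mathsf{node}$. Otherwise let $state'=I.\mathsf{com}.\mathsf{update}(sig[I.\mathsf{id}],I.\mathsf{state})$, $n'=I.\mathsf{com}.\mathsf{view}(state')$, $n''=\mathsf{reconcile}\ sig\ I.\mathsf{node}\ n'$; the result is $\mathsf{inst}(I')$ with $I'$ being $I$ with $\mathsf{state}:=state'$ and $\mathsf{node}:=n''$. Here $\mathsf{reconcile}\ sig\ (\mathsf{inst}(J))\ (\mathsf{inst}(J'))=\mathsf{doc\text{-}step}\ sig\ (\mathsf{inst}(J))$ if $J.\mathsf{com}=J'.\mathsf{com}$ and $J.\mathsf{props}=J'.\mathsf{props}$ (for some fixed equality test valid also across existential packages), and $=\mathsf{inst}(J')$ otherwise; for two structure nodes,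 $\mathsf{reconcile}$ keeps the new tag and attributes and reconciles children positionally (surplus new children are kept unchanged, surplus old children dropped); in all other cases it returns the new tree. Write $v_i=\mathsf{doc\text{-}step}^i(v_0)$ when there are signal maps $sig_1,\dots,sig_i$ with $v_j=\mathsf{doc\text{-}step}\ sig_j\ v_{j-1}$ for $1\le j\le i$ (all assumed to be defined, i.e. the invoked user functions terminate); the sequence $v_0,v_1,\dots,v_i$ is fixed. $\mathsf{doc\text{-}view}:\mathsf{ReactNode}\to\mathsf{NodeTy}$ replaces instances by their contents: it is the identity on text, recurses on the children of structure nodes, and $\mathsf{doc\text{-}view}(\mathsf{inst}(I))=\mathsf{doc\text{-}view}(I.\mathsf{node})$. Set $a_j=\mathsf{doc\text{-}view}(v_j)$. **Sections and references.** An identifier context $\Delta$ is a list of pairs (string, list of integers), used as an association list. $\mathsf{sections\text{-}at}$ takes a nonempty list of integers (current section number, innermost counter first) and a tree or list of trees, and returns an identifier context and an updated counter list: - on $\mathsf{text}(s)$ with counter $c$: returns $([],c)$; - on a node with tag "section" and an "id" attribute with value $id$, with counter $k::ks$: let $(\Delta,\_)$ be the result of $\mathsf{sections\text{-}at}$ on the child list with counter $1::k::ks$; return $((id,k::ks)::\Delta,\ (k+1)::ks)$; a section without an id is treated in the same way but contributes no entry of its own; - on any other node: the result of $\mathsf{sections\text{-}at}$ on the child list with the same counter; - on a list: process elements left to right, threading the counter and concatenating the contexts. $\mathsf{sections}(a)$ is the first component of $\mathsf{sections\text{-}at}$ on $a$ with counter $[1]$. $\mathsf{replace\text{-}refs}(a,\Delta)$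 replaces each node $\mathsf{node}(\text{"ref"},[(\text{"target"},id)],[])$ in $a$ by $\mathsf{text}(f(\Delta[id]))$, where $f$ is a fixed function turning section numbers into strings, and leaves the rest of the tree unchanged (it is undefined if some needed $\Delta[id]$ does not exist; equality of possibly undefined results means both are undefined or both are defined and equal). $\mathsf{render\text{-}refs}(a)=\mathsf{replace\text{-}refs}(a,\mathsf{sections}(a))$. **Dirty check.** For a $\mathsf{ReactNode}$ $n$, $\mathsf{descendents}(n)$ is the set of tags of all structure nodes occurring in $n$ (including $n$ itself, and including those inside nested instances). $\mathsf{dirty}$ is the predicate on pairs of $\mathsf{ReactNode}$s with $$\mathsf{dirty}(\mathsf{inst}(I),\mathsf{inst}(I'))\iff \text{"section"}\in\mathsf{descendents}(I.\mathsf{node})\cup\mathsf{descendents}(I'.\mathsf{node})\ \text{ or }\ \mathsf{dirty}(I.\mathsf{node},I'.\mathsf{node}),$$ on two structure nodes it holds iff it holds for some pair of children in the same position, and it is false in all other cases. **The two strategies.** $\mathsf{simple}(a_i)=\mathsf{render\text{-}refs}(a_i)$. Define $\Delta^{\mathsf{incr}}_i=\mathsf{sections}(a_i)$ if $i=0$ or $\mathsf{dirty}(v_{i-1},v_i)$, and $\Delta^{\mathsf{incr}}_i=\Delta^{\mathsf{incr}}_{i-1}$ otherwise. Then $\mathsf{incr}(a_i)=\mathsf{replace\text{-}refs}(a_i,\Delta^{\mathsf{incr}}_i)$. *)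

theory Defs
  imports Main
begin

section \<open>The calculus: types\<close>

text \<open>Type variables are de Bruijn indices (bound by \<open>Forall\<close>, \<open>Exists\<close>, \<open>Mu\<close>), term variables
  are names.\<close>

type_synonym label = string
type_synonym var = string
type_synonym inst_id = nat

datatype ty =
    TVar nat
  | TStr
  | TId
  | Fun ty ty
  | Forall ty
  | Exists ty
  | Mu ty
  | Prod "(label \<times> ty) list"
  | Sum "(label \<times> ty) list"

fun lift_ty :: "nat \<Rightarrow> ty \<Rightarrow> ty" where
  "lift_ty k (TVar i) = TVar (if i < k then i else Suc i)"
| "lift_ty k TStr = TStr"
| "lift_ty k TId = TId"
| "lift_ty k (Fun a b) = Fun (lift_ty k a) (lift_ty k b)"
| "lift_ty k (Forall t) = Forall (lift_ty (Suc k) t)"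
| "lift_ty k (Exists t) = Exists (lift_ty (Suc k) t)"
| "lift_ty k (Mu t) = Mu (lift_ty (Suc k) t)"
| "lift_ty k (Prod ts) = Prod (map (\<lambda>(l, t). (l, lift_ty k t)) ts)"
| "lift_ty k (Sum ts) = Sum (map (\<lambda>(l, t). (l, lift_ty k t)) ts)"

text \<open>\<open>tinst_ty k s t\<close> replaces index \<open>k\<close> in \<open>t\<close> by \<open>s\<close> and lowers the indices above \<open>k\<close>.\<close>

fun tinst_ty :: "nat \<Rightarrow> ty \<Rightarrow> ty \<Rightarrow> ty" where
  "tinst_ty k s (TVar i) = (if i < k then TVar i else if i = k then s else TVar (i - 1))"
| "tinst_ty k s TStr = TStr"
| "tinst_ty k s TId = TId"
| "tinst_ty k s (Fun a b) = Fun (tinst_ty k s a) (tinst_ty k s b)"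
| "tinst_ty k s (Forall t) = Forall (tinst_ty (Suc k) (lift_ty 0 s) t)"
| "tinst_ty k s (Exists t) = Exists (tinst_ty (Suc k) (lift_ty 0 s) t)"
| "tinst_ty k s (Mu t) = Mu (tinst_ty (Suc k) (lift_ty 0 s) t)"
| "tinst_ty k s (Prod ts) = Prod (map (\<lambda>(l, t). (l, tinst_ty k s t)) ts)"
| "tinst_ty k s (Sum ts) = Sum (map (\<lambda>(l, t). (l, tinst_ty k s t)) ts)"

text \<open>Well-formedness in a context of \<open>n\<close> type variables.\<close>

fun wf_ty :: "nat \<Rightarrow> ty \<Rightarrow> bool" where
  "wf_ty n (TVar i) \<longleftrightarrow> i < n"
| "wf_ty n TStr \<longleftrightarrow> True"
| "wf_ty n TId \<longleftrightarrow> True"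
| "wf_ty n (Fun a b) \<longleftrightarrow> wf_ty n a \<and> wf_ty n b"
| "wf_ty n (Forall t) \<longleftrightarrow> wf_ty (Suc n) t"
| "wf_ty n (Exists t) \<longleftrightarrow> wf_ty (Suc n) t"
| "wf_ty n (Mu t) \<longleftrightarrow> wf_ty (Suc n) t"
| "wf_ty n (Prod ts) \<longleftrightarrow> distinct (map fst ts) \<and> (\<forall>(l, t) \<in> set ts. wf_ty n t)"
| "wf_ty n (Sum ts) \<longleftrightarrow> distinct (map fst ts) \<and> (\<forall>(l, t) \<in> set ts. wf_ty n t)"

fun unroll :: "ty \<Rightarrow> ty" where
  "unroll (Mu t) = tinst_ty 0 (Mu t) t"
| "unroll t = t"

definition UnitTy :: ty where "UnitTy = Prod []"
definition BoolTy :: ty where "BoolTy = Sum [(''true'', UnitTy), (''false'', UnitTy)]"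
definition PairTy :: "ty \<Rightarrow> ty \<Rightarrow> ty" where "PairTy a b = Prod [(''fst'', a), (''snd'', b)]"

definition ListTy :: "ty \<Rightarrow> ty" where
  "ListTy t = Mu (Sum [(''nil'', UnitTy), (''cons'', Prod [(''hd'', lift_ty 0 t), (''tl'', TVar 0)])])"

definition AttrsTy :: ty where "AttrsTy = ListTy (PairTy TStr TStr)"

definition ElementTy :: "ty \<Rightarrow> ty" where
  "ElementTy t = Prod [(''tag'', TStr), (''attrs'', AttrsTy), (''children'', ListTy t)]"

definition NodeTy :: ty where
  "NodeTy = Mu (Sum [(''text'', TStr), (''node'', ElementTy (TVar 0))])"

definition SignalTy :: ty where "SignalTy = TStr"

text \<open>Components and instances, parametrised by the type \<open>r\<close> of reactive nodes, so that they can be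
  used both inside and outside of the recursive type \<open>ReactNode\<close>.\<close>

definition ComTy :: "ty \<Rightarrow> ty \<Rightarrow> ty \<Rightarrow> ty" where
  "ComTy r p s = Prod [(''init'', Fun p s), (''update'', Fun (PairTy SignalTy s) s), (''view'', Fun s r)]"

definition InstRecTy :: "ty \<Rightarrow> ty \<Rightarrow> ty \<Rightarrow> ty" where
  "InstRecTy r p s =
     Prod [(''id'', TId), (''com'', ComTy r p s), (''props'', p), (''state'', s), (''node'', r)]"

definition InstExTy :: "ty \<Rightarrow> ty \<Rightarrow> ty" where
  "InstExTy r p = Exists (InstRecTy (lift_ty 0 r) (lift_ty 0 p) (TVar 0))"

definition InstTy :: "ty \<Rightarrow> ty" where
  "InstTy r = Exists (InstExTy (lift_ty 0 r) (TVar 0))"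

definition ReactNode :: ty where
  "ReactNode = Mu (Sum [(''text'', TStr), (''node'', ElementTy (TVar 0)), (''inst'', InstTy (TVar 0))])"


section \<open>The calculus: expressions and templates\<close>

text \<open>\<open>InstId\<close> are the runtime identifiers of instances; they do not occur in source programs (see
  the typing rules). In \<open>Tpl k t\<close>, the kind \<open>k\<close> distinguishes templates for plain trees from
  \<open>reacttpl\<close>. The type arguments of \<open>Instantiate\<close> and \<open>PComponent\<close> are the property type and the
  state type.\<close>

datatype tpl_kind = Tree | React

datatype exp =
    Var var
  | Str string
  | Concat exp exp
  | StrEq exp exp
  | InstId inst_id
  | Lam var ty exp
  | App exp exp
  | TLam exp
  | TApp exp ty
  | Record "(label \<times> exp) list"
  | Proj exp label
  | Inj label exp ty
  | Case exp "(label \<times> var \<times> exp) list"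
  | Cond exp exp exp
  | Fold ty exp
  | Unfold exp
  | Pack ty exp ty
  | Unpack exp var exp
  | Fix var ty exp
  | LetIn var exp exp
  | Instantiate ty ty exp exp
  | Tpl tpl_kind "tpl_part list"
and tpl_part =
    PText exp                                         \<comment> \<open>string, as a text node\<close>
  | PElem exp                                         \<comment> \<open>single node\<close>
  | PSplice exp                                       \<comment> \<open>list of nodes\<close>
  | PNode string "(string \<times> exp) list" "tpl_part list"
  | PSet var exp                                      \<comment> \<open>binds in the remaining parts\<close>
  | PIf exp "tpl_part list" "tpl_part list"
  | PForeach var ty exp "tpl_part list"
  | PComponent ty ty exp exp

text \<open>Substitution. Evaluation only substitutes closed expressions, so no variable capture can occur.\<close>

fun subst :: "var \<Rightarrow> exp \<Rightarrow> exp \<Rightarrow> exp"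
  and subst_tpl :: "var \<Rightarrow> exp \<Rightarrow> tpl_part list \<Rightarrow> tpl_part list" where
  "subst x v (Var y) = (if x = y then v else Var y)"
| "subst x v (Str s) = Str s"
| "subst x v (Concat e1 e2) = Concat (subst x v e1) (subst x v e2)"
| "subst x v (StrEq e1 e2) = StrEq (subst x v e1) (subst x v e2)"
| "subst x v (InstId i) = InstId i"
| "subst x v (Lam y t e) = Lam y t (if x = y then e else subst x v e)"
| "subst x v (App e1 e2) = App (subst x v e1) (subst x v e2)"
| "subst x v (TLam e) = TLam (subst x v e)"
| "subst x v (TApp e t) = TApp (subst x v e) t"
| "subst x v (Record fs) = Record (map (\<lambda>(l, e). (l, subst x v e)) fs)"
| "subst x v (Proj e l) = Proj (subst x v e) l"
| "subst x v (Inj l e t) = Inj l (subst x v e) t"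
| "subst x v (Case e bs) =
     Case (subst x v e) (map (\<lambda>(l, y, b). (l, y, if x = y then b else subst x v b)) bs)"
| "subst x v (Cond e1 e2 e3) = Cond (subst x v e1) (subst x v e2) (subst x v e3)"
| "subst x v (Fold t e) = Fold t (subst x v e)"
| "subst x v (Unfold e) = Unfold (subst x v e)"
| "subst x v (Pack s e t) = Pack s (subst x v e) t"
| "subst x v (Unpack e1 y e2) = Unpack (subst x v e1) y (if x = y then e2 else subst x v e2)"
| "subst x v (Fix y t e) = Fix y t (if x = y then e else subst x v e)"
| "subst x v (LetIn y e1 e2) = LetIn y (subst x v e1) (if x = y then e2 else subst x v e2)"
| "subst x v (Instantiate p s e1 e2) = Instantiate p s (subst x v e1) (subst x v e2)"
| "subst x v (Tpl k t) = Tpl k (subst_tpl x v t)"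
| "subst_tpl x v [] = []"
| "subst_tpl x v (PText e # ps) = PText (subst x v e) # subst_tpl x v ps"
| "subst_tpl x v (PElem e # ps) = PElem (subst x v e) # subst_tpl x v ps"
| "subst_tpl x v (PSplice e # ps) = PSplice (subst x v e) # subst_tpl x v ps"
| "subst_tpl x v (PNode s at t # ps) =
     PNode s (map (\<lambda>(k, e). (k, subst x v e)) at) (subst_tpl x v t) # subst_tpl x v ps"
| "subst_tpl x v (PSet y e # ps) =
     PSet y (subst x v e) # (if x = y then ps else subst_tpl x v ps)"
| "subst_tpl x v (PIf e t1 t2 # ps) =
     PIf (subst x v e) (subst_tpl x v t1) (subst_tpl x v t2) # subst_tpl x v ps"
| "subst_tpl x v (PForeach y s e t # ps) =
     PForeach y s (subst x v e) (if x = y then t else subst_tpl x v t) # subst_tpl x v ps"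
| "subst_tpl x v (PComponent p s e1 e2 # ps) =
     PComponent p s (subst x v e1) (subst x v e2) # subst_tpl x v ps"

text \<open>Instantiation of a type variable in an expression.\<close>

fun tinst_exp :: "nat \<Rightarrow> ty \<Rightarrow> exp \<Rightarrow> exp"
  and tinst_part :: "nat \<Rightarrow> ty \<Rightarrow> tpl_part \<Rightarrow> tpl_part" where
  "tinst_exp k a (Var y) = Var y"
| "tinst_exp k a (Str s) = Str s"
| "tinst_exp k a (Concat e1 e2) = Concat (tinst_exp k a e1) (tinst_exp k a e2)"
| "tinst_exp k a (StrEq e1 e2) = StrEq (tinst_exp k a e1) (tinst_exp k a e2)"
| "tinst_exp k a (InstId i) = InstId i"
| "tinst_exp k a (Lam y t e) = Lam y (tinst_ty k a t) (tinst_exp k a e)"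
| "tinst_exp k a (App e1 e2) = App (tinst_exp k a e1) (tinst_exp k a e2)"
| "tinst_exp k a (TLam e) = TLam (tinst_exp (Suc k) (lift_ty 0 a) e)"
| "tinst_exp k a (TApp e t) = TApp (tinst_exp k a e) (tinst_ty k a t)"
| "tinst_exp k a (Record fs) = Record (map (\<lambda>(l, e). (l, tinst_exp k a e)) fs)"
| "tinst_exp k a (Proj e l) = Proj (tinst_exp k a e) l"
| "tinst_exp k a (Inj l e t) = Inj l (tinst_exp k a e) (tinst_ty k a t)"
| "tinst_exp k a (Case e bs) = Case (tinst_exp k a e) (map (\<lambda>(l, y, b). (l, y, tinst_exp k a b)) bs)"
| "tinst_exp k a (Cond e1 e2 e3) = Cond (tinst_exp k a e1) (tinst_exp k a e2) (tinst_exp k a e3)"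
| "tinst_exp k a (Fold t e) = Fold (tinst_ty k a t) (tinst_exp k a e)"
| "tinst_exp k a (Unfold e) = Unfold (tinst_exp k a e)"
| "tinst_exp k a (Pack s e t) = Pack (tinst_ty k a s) (tinst_exp k a e) (tinst_ty k a t)"
| "tinst_exp k a (Unpack e1 y e2) = Unpack (tinst_exp k a e1) y (tinst_exp (Suc k) (lift_ty 0 a) e2)"
| "tinst_exp k a (Fix y t e) = Fix y (tinst_ty k a t) (tinst_exp k a e)"
| "tinst_exp k a (LetIn y e1 e2) = LetIn y (tinst_exp k a e1) (tinst_exp k a e2)"
| "tinst_exp k a (Instantiate p s e1 e2) =
     Instantiate (tinst_ty k a p) (tinst_ty k a s) (tinst_exp k a e1) (tinst_exp k a e2)"
| "tinst_exp k a (Tpl q t) = Tpl q (map (tinst_part k a) t)"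
| "tinst_part k a (PText e) = PText (tinst_exp k a e)"
| "tinst_part k a (PElem e) = PElem (tinst_exp k a e)"
| "tinst_part k a (PSplice e) = PSplice (tinst_exp k a e)"
| "tinst_part k a (PNode s at t) =
     PNode s (map (\<lambda>(l, e). (l, tinst_exp k a e)) at) (map (tinst_part k a) t)"
| "tinst_part k a (PSet y e) = PSet y (tinst_exp k a e)"
| "tinst_part k a (PIf e t1 t2) =
     PIf (tinst_exp k a e) (map (tinst_part k a) t1) (map (tinst_part k a) t2)"
| "tinst_part k a (PForeach y s e t) =
     PForeach y (tinst_ty k a s) (tinst_exp k a e) (map (tinst_part k a) t)"
| "tinst_part k a (PComponent p s e1 e2) =
     PComponent (tinst_ty k a p) (tinst_ty k a s) (tinst_exp k a e1) (tinst_exp k a e2)"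


section \<open>Desugaring of templates\<close>

definition in_rec :: "ty \<Rightarrow> label \<Rightarrow> exp \<Rightarrow> exp" where
  "in_rec t l e = Fold t (Inj l e (unroll t))"

definition nil_exp :: "ty \<Rightarrow> exp" where
  "nil_exp t = in_rec (ListTy t) ''nil'' (Record [])"

definition cons_exp :: "ty \<Rightarrow> exp \<Rightarrow> exp \<Rightarrow> exp" where
  "cons_exp t e1 e2 = in_rec (ListTy t) ''cons'' (Record [(''hd'', e1), (''tl'', e2)])"

definition list_exp :: "ty \<Rightarrow> exp list \<Rightarrow> exp" where
  "list_exp t es = foldr (cons_exp t) es (nil_exp t)"

definition pair_exp :: "exp \<Rightarrow> exp \<Rightarrow> exp" where
  "pair_exp e1 e2 = Record [(''fst'', e1), (''snd'', e2)]"

definition bool_exp :: "bool \<Rightarrow> exp" where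
  "bool_exp b = Inj (if b then ''true'' else ''false'') (Record []) BoolTy"

text \<open>Trees, for \<open>r\<close> being \<open>NodeTy\<close> or \<open>ReactNode\<close>.\<close>

definition text_exp :: "ty \<Rightarrow> exp \<Rightarrow> exp" where
  "text_exp r e = in_rec r ''text'' e"

definition node_exp :: "ty \<Rightarrow> string \<Rightarrow> (string \<times> exp) list \<Rightarrow> exp \<Rightarrow> exp" where
  "node_exp r s at e = in_rec r ''node'' (Record
     [(''tag'', Str s),
      (''attrs'', list_exp (PairTy TStr TStr) (map (\<lambda>(k, a). pair_exp (Str k) a) at)),
      (''children'', e)])"

text \<open>The list combinators below are closed, hence desugaring does not capture variables.\<close>

definition append_exp :: "ty \<Rightarrow> exp" where
  "append_exp t =
     Fix ''append'' (Fun (ListTy t) (Fun (ListTy t) (ListTy t)))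
       (Lam ''xs'' (ListTy t) (Lam ''ys'' (ListTy t)
         (Case (Unfold (Var ''xs''))
            [(''nil'', ''u'', Var ''ys''),
             (''cons'', ''c'', cons_exp t (Proj (Var ''c'') ''hd'')
                (App (App (Var ''append'') (Proj (Var ''c'') ''tl'')) (Var ''ys'')))])))"

definition flatmap_exp :: "ty \<Rightarrow> ty \<Rightarrow> exp" where
  "flatmap_exp s t =
     Fix ''flatmap'' (Fun (Fun s (ListTy t)) (Fun (ListTy s) (ListTy t)))
       (Lam ''f'' (Fun s (ListTy t)) (Lam ''xs'' (ListTy s)
         (Case (Unfold (Var ''xs''))
            [(''nil'', ''u'', nil_exp t),
             (''cons'', ''c'', App (App (append_exp t) (App (Var ''f'') (Proj (Var ''c'') ''hd'')))
                (App (App (Var ''flatmap'') (Var ''f'')) (Proj (Var ''c'') ''tl'')))])))"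

text \<open>\<open>desugar r t\<close> is an expression of type \<open>ListTy r\<close>. For \<open>r = NodeTy\<close> the desugaring of a
  component is not typable: components can only occur in reactive templates.\<close>

fun desugar :: "ty \<Rightarrow> tpl_part list \<Rightarrow> exp"
  and desugar_part :: "ty \<Rightarrow> tpl_part \<Rightarrow> exp" where
  "desugar r [] = nil_exp r"
| "desugar r (p # ps) =
     (case p of
        PSet x e \<Rightarrow> LetIn x e (desugar r ps)
      | _ \<Rightarrow> App (App (append_exp r) (desugar_part r p)) (desugar r ps))"
| "desugar_part r (PText e) = list_exp r [text_exp r e]"
| "desugar_part r (PElem e) = list_exp r [e]"
| "desugar_part r (PSplice e) = e"
| "desugar_part r (PNode s at t) = list_exp r [node_exp r s at (desugar r t)]"
| "desugar_part r (PSet x e) = nil_exp r"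
| "desugar_part r (PIf e t1 t2) = Cond e (desugar r t1) (desugar r t2)"
| "desugar_part r (PForeach x s e t) = App (App (flatmap_exp s r) (Lam x s (desugar r t))) e"
| "desugar_part r (PComponent p s e1 e2) = list_exp r [in_rec r ''inst'' (Instantiate p s e1 e2)]"

fun tpl_ty :: "tpl_kind \<Rightarrow> ty" where
  "tpl_ty Tree = NodeTy"
| "tpl_ty React = ReactNode"


section \<open>Typing\<close>

text \<open>\<open>has_type I n G e t\<close>: in a context of \<open>n\<close> type variables and term variables \<open>G\<close>, the expression
  \<open>e\<close>, all of whose instance identifiers belong to \<open>I\<close>, has type \<open>t\<close>. Source programs are typed with
  \<open>I = {}\<close>.\<close>

inductive has_type :: "inst_id set \<Rightarrow> nat \<Rightarrow> (var \<times> ty) list \<Rightarrow> exp \<Rightarrow> ty \<Rightarrow> bool"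
  for I :: "inst_id set" where
  T_Var: "map_of G x = Some t \<Longrightarrow> has_type I n G (Var x) t"
| T_Str: "has_type I n G (Str s) TStr"
| T_Concat: "has_type I n G e1 TStr \<Longrightarrow> has_type I n G e2 TStr \<Longrightarrow> has_type I n G (Concat e1 e2) TStr"
| T_StrEq: "has_type I n G e1 TStr \<Longrightarrow> has_type I n G e2 TStr \<Longrightarrow> has_type I n G (StrEq e1 e2) BoolTy"
| T_InstId: "i \<in> I \<Longrightarrow> has_type I n G (InstId i) TId"
| T_Lam: "wf_ty n s \<Longrightarrow> has_type I n ((x, s) # G) e t \<Longrightarrow> has_type I n G (Lam x s e) (Fun s t)"
| T_App: "has_type I n G e1 (Fun s t) \<Longrightarrow> has_type I n G e2 s \<Longrightarrow> has_type I n G (App e1 e2) t"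
| T_TLam: "has_type I (Suc n) (map (\<lambda>(x, s). (x, lift_ty 0 s)) G) e t
    \<Longrightarrow> has_type I n G (TLam e) (Forall t)"
| T_TApp: "has_type I n G e (Forall t) \<Longrightarrow> wf_ty n s \<Longrightarrow> has_type I n G (TApp e s) (tinst_ty 0 s t)"
| T_Record: "distinct (map fst fs)
    \<Longrightarrow> list_all2 (\<lambda>p q. fst p = fst q \<and> has_type I n G (snd p) (snd q)) fs ts
    \<Longrightarrow> has_type I n G (Record fs) (Prod ts)"
| T_Proj: "has_type I n G e (Prod ts) \<Longrightarrow> map_of ts l = Some t \<Longrightarrow> has_type I n G (Proj e l) t"
| T_Inj: "wf_ty n (Sum ts) \<Longrightarrow> map_of ts l = Some t \<Longrightarrow> has_type I n G e t
    \<Longrightarrow> has_type I n G (Inj l e (Sum ts)) (Sum ts)"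
| T_Case: "has_type I n G e (Sum ts) \<Longrightarrow> wf_ty n t
    \<Longrightarrow> list_all2 (\<lambda>b q. fst b = fst q \<and>
          has_type I n ((fst (snd b), snd q) # G) (snd (snd b)) t) bs ts
    \<Longrightarrow> has_type I n G (Case e bs) t"
| T_Cond: "has_type I n G e1 BoolTy \<Longrightarrow> has_type I n G e2 t \<Longrightarrow> has_type I n G e3 t
    \<Longrightarrow> has_type I n G (Cond e1 e2 e3) t"
| T_Fold: "wf_ty n (Mu t) \<Longrightarrow> has_type I n G e (unroll (Mu t)) \<Longrightarrow> has_type I n G (Fold (Mu t) e) (Mu t)"
| T_Unfold: "has_type I n G e (Mu t) \<Longrightarrow> has_type I n G (Unfold e) (unroll (Mu t))"
| T_Pack: "wf_ty n s \<Longrightarrow> wf_ty n (Exists t) \<Longrightarrow> has_type I n G e (tinst_ty 0 s t)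
    \<Longrightarrow> has_type I n G (Pack s e (Exists t)) (Exists t)"
| T_Unpack: "has_type I n G e1 (Exists s) \<Longrightarrow> wf_ty n t
    \<Longrightarrow> has_type I (Suc n) ((x, s) # map (\<lambda>(y, u). (y, lift_ty 0 u)) G) e2 (lift_ty 0 t)
    \<Longrightarrow> has_type I n G (Unpack e1 x e2) t"
| T_Fix: "wf_ty n t \<Longrightarrow> has_type I n ((x, t) # G) e t \<Longrightarrow> has_type I n G (Fix x t e) t"
| T_LetIn: "has_type I n G e1 s \<Longrightarrow> has_type I n ((x, s) # G) e2 t \<Longrightarrow> has_type I n G (LetIn x e1 e2) t"
| T_Instantiate: "wf_ty n p \<Longrightarrow> wf_ty n s \<Longrightarrow> has_type I n G e1 (ComTy ReactNode p s)
    \<Longrightarrow> has_type I n G e2 p \<Longrightarrow> has_type I n G (Instantiate p s e1 e2) (InstTy ReactNode)"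
| T_Tpl: "has_type I n G (desugar (tpl_ty k) t) (ListTy (tpl_ty k))
    \<Longrightarrow> has_type I n G (Tpl k t) (ListTy (tpl_ty k))"


section \<open>Evaluation\<close>

definition inst_pack :: "ty \<Rightarrow> ty \<Rightarrow> inst_id \<Rightarrow> exp \<Rightarrow> exp \<Rightarrow> exp \<Rightarrow> exp \<Rightarrow> exp" where
  "inst_pack p s i c pr st nd =
     Pack p (Pack s (Record [(''id'', InstId i), (''com'', c), (''props'', pr), (''state'', st), (''node'', nd)])
       (InstExTy ReactNode p)) (InstTy ReactNode)"

text \<open>Call-by-value big-step evaluation. \<open>eval U e v U'\<close>: with \<open>U\<close> the identifiers in use, \<open>e\<close>
  evaluates to \<open>v\<close>, and \<open>U'\<close> are the identifiers in use afterwards. Identifiers are only generated by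
  \<open>Instantiate\<close>.\<close>

inductive eval :: "inst_id set \<Rightarrow> exp \<Rightarrow> exp \<Rightarrow> inst_id set \<Rightarrow> bool"
  and eval_fields :: "inst_id set \<Rightarrow> (label \<times> exp) list \<Rightarrow> (label \<times> exp) list \<Rightarrow> inst_id set \<Rightarrow> bool" where
  E_Str: "eval U (Str s) (Str s) U"
| E_Concat: "eval U e1 (Str s1) U1 \<Longrightarrow> eval U1 e2 (Str s2) U2 \<Longrightarrow> eval U (Concat e1 e2) (Str (s1 @ s2)) U2"
| E_StrEq: "eval U e1 (Str s1) U1 \<Longrightarrow> eval U1 e2 (Str s2) U2
    \<Longrightarrow> eval U (StrEq e1 e2) (bool_exp (s1 = s2)) U2"
| E_InstId: "eval U (InstId i) (InstId i) U"
| E_Lam: "eval U (Lam x t e) (Lam x t e) U"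
| E_App: "eval U e1 (Lam x t e) U1 \<Longrightarrow> eval U1 e2 w U2 \<Longrightarrow> eval U2 (subst x w e) v U3
    \<Longrightarrow> eval U (App e1 e2) v U3"
| E_TLam: "eval U (TLam e) (TLam e) U"
| E_TApp: "eval U e (TLam e1) U1 \<Longrightarrow> eval U1 (tinst_exp 0 t e1) v U2 \<Longrightarrow> eval U (TApp e t) v U2"
| E_Record: "eval_fields U fs vs U1 \<Longrightarrow> eval U (Record fs) (Record vs) U1"
| E_Proj: "eval U e (Record vs) U1 \<Longrightarrow> map_of vs l = Some v \<Longrightarrow> eval U (Proj e l) v U1"
| E_Inj: "eval U e v U1 \<Longrightarrow> eval U (Inj l e t) (Inj l v t) U1"
| E_Case: "eval U e (Inj l w t) U1 \<Longrightarrow> map_of bs l = Some (x, b) \<Longrightarrow> eval U1 (subst x w b) v U2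
    \<Longrightarrow> eval U (Case e bs) v U2"
| E_Cond: "eval U e1 (bool_exp b) U1 \<Longrightarrow> eval U1 (if b then e2 else e3) v U2
    \<Longrightarrow> eval U (Cond e1 e2 e3) v U2"
| E_Fold: "eval U e v U1 \<Longrightarrow> eval U (Fold t e) (Fold t v) U1"
| E_Unfold: "eval U e (Fold t v) U1 \<Longrightarrow> eval U (Unfold e) v U1"
| E_Pack: "eval U e v U1 \<Longrightarrow> eval U (Pack s e t) (Pack s v t) U1"
| E_Unpack: "eval U e1 (Pack s w t) U1 \<Longrightarrow> eval U1 (subst x w (tinst_exp 0 s e2)) v U2
    \<Longrightarrow> eval U (Unpack e1 x e2) v U2"
| E_Fix: "eval U (subst x (Fix x t e) e) v U1 \<Longrightarrow> eval U (Fix x t e) v U1"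
| E_LetIn: "eval U e1 w U1 \<Longrightarrow> eval U1 (subst x w e2) v U2 \<Longrightarrow> eval U (LetIn x e1 e2) v U2"
| E_Instantiate: "eval U e1 c U1 \<Longrightarrow> eval U1 e2 pr U2
    \<Longrightarrow> eval U2 (App (Proj c ''init'') pr) st U3
    \<Longrightarrow> eval U3 (App (Proj c ''view'') st) nd U4
    \<Longrightarrow> i \<notin> U4
    \<Longrightarrow> eval U (Instantiate p s e1 e2) (inst_pack p s i c pr st nd) (insert i U4)"
| E_Tpl: "eval U (desugar (tpl_ty k) t) v U1 \<Longrightarrow> eval U (Tpl k t) v U1"
| E_Nil: "eval_fields U [] [] U"
| E_Cons: "eval U e v U1 \<Longrightarrow> eval_fields U1 fs vs U2 \<Longrightarrow> eval_fields U ((l, e) # fs) ((l, v) # vs) U2"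


section \<open>Documents\<close>

type_synonym attrs = "(string \<times> string) list"

datatype doc =
    Text string
  | Node string attrs "doc list"

text \<open>\<open>react_node\<close> represents the closed values of type \<open>ReactNode\<close>: these are exactly the
  well-typed expressions of the form \<open>enc n\<close> with values in place of the components, properties and
  states. \<open>Instance\<close> also records the two witness types of the existential package.\<close>

datatype react_node =
    RText string
  | RNode string attrs "react_node list"
  | RInst inst
and inst =
  Instance (prop_ty: ty) (state_ty: ty) (iid: inst_id) (com: exp) (props: exp) (state: exp) (node: react_node)

fun enc :: "react_node \<Rightarrow> exp" where
  "enc (RText s) = text_exp ReactNode (Str s)"
| "enc (RNode s at ns) =
     node_exp ReactNode s (map (\<lambda>(k, a). (k, Str a)) at) (list_exp ReactNode (map enc ns))"
| "enc (RInst (Instance p s i c pr st n)) =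
     in_rec ReactNode ''inst'' (inst_pack p s i c pr st (enc n))"


section \<open>The reactive runtime\<close>

text \<open>Stepping is a relation because user functions may diverge and fresh identifiers are chosen
  arbitrarily: \<open>doc_step eqv sig U n U' n'\<close> threads the set of identifiers in use through the
  evaluation of user functions. The parameter \<open>eqv\<close> is the equality test for components and
  properties; it is applied to the underlying values irrespective of their types.\<close>

inductive doc_step :: "(exp \<Rightarrow> exp \<Rightarrow> bool) \<Rightarrow> (inst_id \<rightharpoonup> string) \<Rightarrow>
      inst_id set \<Rightarrow> react_node \<Rightarrow> inst_id set \<Rightarrow> react_node \<Rightarrow> bool"
  and doc_step_list :: "(exp \<Rightarrow> exp \<Rightarrow> bool) \<Rightarrow> (inst_id \<rightharpoonup> string) \<Rightarrow>
      inst_id set \<Rightarrow> react_node list \<Rightarrow> inst_id set \<Rightarrow> react_node list \<Rightarrow> bool"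
  and reconcile :: "(exp \<Rightarrow> exp \<Rightarrow> bool) \<Rightarrow> (inst_id \<rightharpoonup> string) \<Rightarrow>
      inst_id set \<Rightarrow> react_node \<Rightarrow> react_node \<Rightarrow> inst_id set \<Rightarrow> react_node \<Rightarrow> bool"
  and reconcile_list :: "(exp \<Rightarrow> exp \<Rightarrow> bool) \<Rightarrow> (inst_id \<rightharpoonup> string) \<Rightarrow>
      inst_id set \<Rightarrow> react_node list \<Rightarrow> react_node list \<Rightarrow> inst_id set \<Rightarrow> react_node list \<Rightarrow> bool"
  for eqv :: "exp \<Rightarrow> exp \<Rightarrow> bool" and sig :: "inst_id \<rightharpoonup> string" where
  step_text: "doc_step eqv sig U (RText s) U (RText s)"
| step_node: "doc_step_list eqv sig U ns U' ns' \<Longrightarrow> doc_step eqv sig U (RNode s at ns) U' (RNode s at ns')"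
| step_inst_idle: "sig i = None \<Longrightarrow> doc_step eqv sig U n U' n'
    \<Longrightarrow> doc_step eqv sig U (RInst (Instance p s i c pr st n)) U' (RInst (Instance p s i c pr st n'))"
| step_inst_signal: "sig i = Some m
    \<Longrightarrow> eval U (App (Proj c ''update'') (pair_exp (Str m) st)) st' U1
    \<Longrightarrow> eval U1 (App (Proj c ''view'') st') (enc n') U2
    \<Longrightarrow> reconcile eqv sig U2 n n' U3 n''
    \<Longrightarrow> doc_step eqv sig U (RInst (Instance p s i c pr st n)) U3 (RInst (Instance p s i c pr st' n''))"
| step_Nil: "doc_step_list eqv sig U [] U []"
| step_Cons: "doc_step eqv sig U n U1 n' \<Longrightarrow> doc_step_list eqv sig U1 ns U2 ns'
    \<Longrightarrow> doc_step_list eqv sig U (n # ns) U2 (n' # ns')"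
| rec_inst_keep: "eqv (com J) (com J') \<Longrightarrow> eqv (props J) (props J')
    \<Longrightarrow> doc_step eqv sig U (RInst J) U' n
    \<Longrightarrow> reconcile eqv sig U (RInst J) (RInst J') U' n"
| rec_inst_new: "\<not> (eqv (com J) (com J') \<and> eqv (props J) (props J'))
    \<Longrightarrow> reconcile eqv sig U (RInst J) (RInst J') U (RInst J')"
| rec_node: "reconcile_list eqv sig U ns ns' U' ns''
    \<Longrightarrow> reconcile eqv sig U (RNode s at ns) (RNode s' at' ns') U' (RNode s' at' ns'')"
| rec_other: "\<nexists>J J'. n = RInst J \<and> n' = RInst J'
    \<Longrightarrow> \<nexists>s at ns s' at' ns'. n = RNode s at ns \<and> n' = RNode s' at' ns'
    \<Longrightarrow> reconcile eqv sig U n n' U n'"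
| rec_surplus_old: "reconcile_list eqv sig U ns [] U []"
| rec_surplus_new: "reconcile_list eqv sig U [] ns' U ns'"
| rec_Cons: "reconcile eqv sig U n n' U1 n'' \<Longrightarrow> reconcile_list eqv sig U1 ns ns' U2 ns''
    \<Longrightarrow> reconcile_list eqv sig U (n # ns) (n' # ns') U2 (n'' # ns'')"

text \<open>\<open>doc_steps eqv U0 v i\<close>: \<open>v 0, \<dots>, v i\<close> is a sequence of \<open>i\<close> steps of the runtime, started with
  the identifiers \<open>U0\<close> in use.\<close>

definition doc_steps :: "(exp \<Rightarrow> exp \<Rightarrow> bool) \<Rightarrow> inst_id set \<Rightarrow> (nat \<Rightarrow> react_node) \<Rightarrow> nat \<Rightarrow> bool" where
  "doc_steps eqv U0 v i \<longleftrightarrow>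
     (\<exists>sig U. U 0 = U0 \<and>
        (\<forall>j \<in> {1..i}. finite (dom (sig j)) \<and> doc_step eqv (sig j) (U (j - 1)) (v (j - 1)) (U j) (v j)))"

fun doc_view :: "react_node \<Rightarrow> doc" where
  "doc_view (RText s) = Text s"
| "doc_view (RNode s at ns) = Node s at (map doc_view ns)"
| "doc_view (RInst (Instance p s i c pr st n)) = doc_view n"


section \<open>Sections and references\<close>

type_synonym id_ctx = "(string \<times> int list) list"

text \<open>The counter list is always nonempty.\<close>

fun sections_at :: "int list \<Rightarrow> doc \<Rightarrow> id_ctx \<times> int list"
  and sections_at_list :: "int list \<Rightarrow> doc list \<Rightarrow> id_ctx \<times> int list" where
  "sections_at c (Text s) = ([], c)"
| "sections_at c (Node s at ns) =
     (if s = ''section'' then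
        let k = hd c; ks = tl c; D = fst (sections_at_list (1 # k # ks) ns)
        in (case map_of at ''id'' of Some x \<Rightarrow> (x, k # ks) # D | None \<Rightarrow> D, (k + 1) # ks)
      else sections_at_list c ns)"
| "sections_at_list c [] = ([], c)"
| "sections_at_list c (a # as) =
     (let (D1, c1) = sections_at c a; (D2, c2) = sections_at_list c1 as in (D1 @ D2, c2))"

definition sections :: "doc \<Rightarrow> id_ctx" where
  "sections a = fst (sections_at [1] a)"

text \<open>\<open>None\<close> means undefined; \<open>f\<close> converts section numbers to strings.\<close>

fun replace_refs :: "(int list \<Rightarrow> string) \<Rightarrow> doc \<Rightarrow> id_ctx \<Rightarrow> doc option" where
  "replace_refs f (Text s) D = Some (Text s)"
| "replace_refs f (Node s at ns) D =
     (if s = ''ref'' \<and> map fst at = [''target''] \<and> ns = []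
      then map_option (\<lambda>c. Text (f c)) (map_of D (snd (hd at)))
      else map_option (Node s at) (those (map (\<lambda>n. replace_refs f n D) ns)))"

definition render_refs :: "(int list \<Rightarrow> string) \<Rightarrow> doc \<Rightarrow> doc option" where
  "render_refs f a = replace_refs f a (sections a)"


section \<open>The two strategies\<close>

fun descendents :: "react_node \<Rightarrow> string set" where
  "descendents (RText s) = {}"
| "descendents (RNode s at ns) = insert s (\<Union>n \<in> set ns. descendents n)"
| "descendents (RInst (Instance p s i c pr st n)) = descendents n"

function (sequential) dirty :: "react_node \<Rightarrow> react_node \<Rightarrow> bool" where
  "dirty (RInst (Instance p s i c pr st n)) (RInst (Instance p' s' i' c' pr' st' n')) \<longleftrightarrow>
     ''section'' \<in> descendents n \<union> descendents n' \<or> dirty n n'"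
| "dirty (RNode s at ns) (RNode s' at' ns') \<longleftrightarrow> (\<exists>(n, n') \<in> set (zip ns ns'). dirty n n')"
| "dirty _ _ \<longleftrightarrow> False"
  by pat_completeness auto
termination
  by (relation "measure (\<lambda>(n, n'). size n)")
    (auto dest!: set_zip_leftD intro: size_list_estimation' simp: less_Suc_eq_le)

definition simple :: "(int list \<Rightarrow> string) \<Rightarrow> doc \<Rightarrow> doc option" where
  "simple f a = render_refs f a"

fun incr_ctx :: "(nat \<Rightarrow> react_node) \<Rightarrow> nat \<Rightarrow> id_ctx" where
  "incr_ctx v 0 = sections (doc_view (v 0))"
| "incr_ctx v (Suc i) =
     (if dirty (v i) (v (Suc i)) then sections (doc_view (v (Suc i))) else incr_ctx v i)"

text \<open>\<open>incr f v i\<close> is the incremental rendering of the \<open>i\<close>-th document of the sequence \<open>v\<close>.\<close>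

definition incr :: "(int list \<Rightarrow> string) \<Rightarrow> (nat \<Rightarrow> react_node) \<Rightarrow> nat \<Rightarrow> doc option" where
  "incr f v i = replace_refs f (doc_view (v i)) (incr_ctx v i)"

end

theory Submission
  imports Defs
begin

text \<open>A step changes a document only below its outermost instances. If the step is not dirty, no
  section occurs in an outermost instance before or after it, so these instances contribute no
  identifiers and leave the counter unchanged. Hence the old and the new document have the same
  sections, and the cached identifier context is always the current one.\<close>

lemma sections_at_list_trivial:
  assumes "\<And>a c. a \<in> set as \<Longrightarrow> sections_at c a = ([], c)"
  shows "sections_at_list c as = ([], c)"
  using assms by (induction as arbitrary: c) auto

lemma sections_at_no_section:
  "''section'' \<notin> descendents n \<Longrightarrow> sections_at c (doc_view n) = ([], c)"
  by (induction n arbitrary: c rule: descendents.induct) (auto intro!: sections_at_list_trivial)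

text \<open>The \<open>reconcile\<close> clauses are \<open>True\<close>: whatever it returns inside
  an instance, a clean step has no section in the old or new content, so both sides are
  \<open>([], c)\<close>.\<close>

lemma doc_step_not_dirty_sections_at:
  "doc_step eqv sig U n U' n' \<Longrightarrow> \<not> dirty n n' \<Longrightarrow>
     sections_at c (doc_view n') = sections_at c (doc_view n)"
  and "doc_step_list eqv sig U ns U' ns' \<Longrightarrow> \<forall>(n, n') \<in> set (zip ns ns'). \<not> dirty n n' \<Longrightarrow>
     sections_at_list c (map doc_view ns') = sections_at_list c (map doc_view ns)"
  and "reconcile eqv sig U n m U' n' \<Longrightarrow> True"
  and "reconcile_list eqv sig U ns ms U' ns' \<Longrightarrow> True"
proof (induction arbitrary: c and c rule: doc_step_doc_step_list_reconcile_reconcile_list.inducts)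
  case (step_node U ns U' ns' s at)
  \<comment> \<open>Needed for every counter: a section starts its children at a counter extended by
    1, any other node passes \<open>c\<close> on.\<close>
  then have "sections_at_list c (map doc_view ns') = sections_at_list c (map doc_view ns)" for c
    by (auto simp: case_prod_unfold)
  then show ?case by simp
qed (auto simp: sections_at_no_section)

lemma incr_ctx_eq_sections:
  assumes "doc_steps eqv U0 v i"
  shows "incr_ctx v i = sections (doc_view (v i))"
proof -
  obtain sig U where step: "doc_step eqv (sig j) (U (j - 1)) (v (j - 1)) (U j) (v j)"
    if "j \<in> {1..i}" for j
    using assms unfolding doc_steps_def by blast
  have "incr_ctx v j = sections (doc_view (v j))" if "j \<le> i" for j
    using that
  proof (induction j)
    case (Suc j)
    have "doc_step eqv (sig (Suc j)) (U j) (v j) (U (Suc j)) (v (Suc j))"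
      using step[of "Suc j"] Suc.prems by simp
    \<comment> \<open>A dirty step recomputes the context; a clean one keeps it, justified by the
      step lemma at counter \<open>[1]\<close>.\<close>
    then show ?case
      using Suc by (simp add: sections_def doc_step_not_dirty_sections_at(1))
  qed simp
  then show ?thesis by simp
qed

theorem theorem5p2:
  fixes e :: exp and v :: "nat \<Rightarrow> react_node" and i :: nat
    and U0 :: "inst_id set"
    and eqv :: "exp \<Rightarrow> exp \<Rightarrow> bool" and f :: "int list \<Rightarrow> string"
  assumes "has_type {} 0 [] e ReactNode"
    and "eval {} e (enc (v 0)) U0"
    and "doc_steps eqv U0 v i"
  shows "simple f (doc_view (v i)) = incr f v i"
  by (simp add: simple_def render_refs_def incr_def incr_ctx_eq_sections[OF assms(3)])

end
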